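(* For all $n\geq 1$, $$\hat E^{\rm tot}(Q_n;r,t)=\prod_{k=1}^n\left(1+r^{u_k}+t\,r^{u_k}\right)=\sum_{i=0}^n t^i\left[\sum_{k=i}^n\binom{k}{i}e_k\right],$$ $$\hat E^{\rm ud}(Q_n;r,t)\overset{\circ}{=}\sum_{j=1}^n(1+t)^{j-1}e_j=\sum_{i=0}^{n-1}t^i\left[\sum_{j=i+1}^n\binom{j-1}{i}e_j\right],$$ where $u_k=\dfrac{q_k^2}{x_k^2}+\dfrac{q_k^2}{y_k^2}$, $e_j$ denotes the $j$-th elementary symmetric function in $r^{u_1},\dots,r^{u_n}$, and $\overset{\circ}{=}$ means equality up to terms not involving $r$ (i.e. up to the multiplicity of $0$ as an eigenvalue).
   Context: The $n$-cube $Q_n$ is the poset of $n$-tuples $f=(f_1,\dots,f_n)$ with $f_i\in\{0,1,\circledast\}$, ordered by $f\le g$ iff $f_i\le g_i$ for all $i$, where $0<\circledast$, $1<\circledast$, and $0,1$ are incomparable. The direction of $f$ is $\mathrm{dir}(f)=\{i : f_i=\circledast\}$, $\dim f=|\mathrm{dir}(f)|$, and $(Q_n)_k$ is the set of $k$-dimensional faces. For $f\le g$ with $\dim f=k-1$, $\dim g=k$, write $\mathrm{dir}(g)=\{a_1<\dots<a_k\}$ and $\mathrm{dir}(f)=\mathrm{dir}(g)\setminus\{a_j\}$; put $\varepsilon(f,g)=(-1)^j$ if $f_{a_j}=0$ and $\varepsilon(f,g)=(-1)^{j+1}$ if $f_{a_j}=1$. If $f\not\le g$, put $\varepsilon(f,g)=0$.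 Let $x_i,y_i,q_i$ ($1\le i\le n$) be commuting indeterminates, and weight each face by $\xi_f=\prod_{i:f_i=\circledast}q_i\prod_{i:f_i=0}x_i\prod_{i:f_i=1}y_i$. Let $C_k$ be the free module on $(Q_n)_k$ over the field of rational functions in these indeterminates. The algebraically weighted boundary map is $\hat\partial_k\colon C_k\to C_{k-1}$, $[g]\mapsto\sum_{f\in(Q_n)_{k-1}}\varepsilon(f,g)\frac{\xi_g}{\xi_f}[f]$ (with $\hat\partial_0=0$, $\hat\partial_{n+1}=0$), and the weighted coboundary map is its transpose $\hat\partial^*_k\colon C_{k-1}\to C_k$, $[f]\mapsto\sum_{g\in(Q_n)_k}\varepsilon(f,g)\frac{\xi_g}{\xi_f}[g]$. The weighted Laplacians on $C_k$ are $$\hat L^{\rm ud}_k=\hat\partial_{k+1}\hat\partial^*_{k+1},\qquad \hat L^{\rm du}_k=\hat\partial^*_k\hat\partial_k,\qquad \hat L^{\rm tot}_k=\hat L^{\rm ud}_k+\hat L^{\rm du}_k.$$ For $\bullet\in\{\mathrm{ud},\mathrm{tot}\}$, $\hat s^\bullet_k(Q_n)$ is the multiset of eigenvalues of $\hat L^\bullet_k$, and $\hat E^\bullet(Q_n;r,t)=\sum_{k=0}^n\sum_{\lambda\in\hat s^\bullet_k(Q_n)}t^kr^\lambda$, where $r^\lambda$ is a formal exponential with $r^\lambda r^\mu=r^{\lambda+\mu}$, $r^0=1$. *)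

theory Defs
  imports
    "HOL-Library.Poly_Mapping"
    "HOL-Computational_Algebra.Fraction_Field"
    "HOL-Algebra.Algebraic_Closure_Type"
    "Jordan_Normal_Form.Char_Poly"
begin

section \<open>The cube\<close>

datatype csym = Zero | One | Star

instantiation csym :: order
begin

definition less_eq_csym :: "csym \<Rightarrow> csym \<Rightarrow> bool" where
  "less_eq_csym a b \<longleftrightarrow> a = b \<or> b = Star"

definition less_csym :: "csym \<Rightarrow> csym \<Rightarrow> bool" where
  "less_csym a b \<longleftrightarrow> a \<noteq> Star \<and> b = Star"

instance
  by standard (auto simp: less_eq_csym_def less_csym_def)

end

text \<open>A face of the \<open>n\<close>-cube is a list of length \<open>n\<close>; its coordinates are numbered from 1.\<close>

type_synonym face = "csym list"

definition coord :: "face \<Rightarrow> nat \<Rightarrow> csym" where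
  "coord f i = f ! (i - 1)"

definition face_le :: "face \<Rightarrow> face \<Rightarrow> bool" where
  "face_le = list_all2 (\<le>)"

definition dir :: "face \<Rightarrow> nat set" where
  "dir f = {i \<in> {1..length f}. coord f i = Star}"

definition fdim :: "face \<Rightarrow> nat" where
  "fdim f = card (dir f)"

text \<open>The list fixes an order of the standard basis of the chain groups, so that linear maps
  between them can be given as matrices.\<close>

definition faces :: "nat \<Rightarrow> face list" where
  "faces n = List.n_lists n [Zero, One, Star]"

lemma set_faces: "set (faces n) = {f. length f = n}"
proof -
  have "set xs \<subseteq> {Zero, One, Star}" for xs :: face
    using csym.exhaust by auto
  then show ?thesis
    by (auto simp: faces_def set_n_lists)
qed

lemma distinct_faces: "distinct (faces n)"
  by (simp add: faces_def distinct_n_lists)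

text \<open>Here \<open>a\<close> is the unique direction of \<open>g\<close> that is not a direction of \<open>f\<close>, and \<open>j\<close> is its
  position in the increasing enumeration of \<open>dir g\<close>, counted from 1.\<close>

definition eps :: "face \<Rightarrow> face \<Rightarrow> int" where
  "eps f g =
    (if face_le f g \<and> fdim f + 1 = fdim g then
       let a = (THE a. a \<in> dir g \<and> dir f = dir g - {a});
           j = card {b \<in> dir g. b \<le> a}
       in if coord f a = Zero then (- 1) ^ j else (- 1) ^ (j + 1)
     else 0)"


section \<open>The field of weights\<close>

text \<open>The coefficient field \<open>'k\<close> is arbitrary. One field containing the indeterminates for all
  \<open>i\<close> serves all cubes: only those with index in \<open>{1..n}\<close> occur for the \<open>n\<close>-cube.\<close>

datatype indet = Xvar nat | Yvar nat | Qvar nat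

fun indet_code :: "indet \<Rightarrow> nat" where
  "indet_code (Xvar i) = 3 * i"
| "indet_code (Yvar i) = 3 * i + 1"
| "indet_code (Qvar i) = 3 * i + 2"

lemma indet_code_inject: "indet_code v = indet_code w \<Longrightarrow> v = w"
  by (cases v; cases w; simp; presburger)

text \<open>The order on indeterminates has no mathematical significance. It is what the library needs
  in order to show that polynomials form an integral domain.\<close>

instantiation indet :: linorder
begin

definition less_eq_indet :: "indet \<Rightarrow> indet \<Rightarrow> bool" where
  "less_eq_indet v w \<longleftrightarrow> indet_code v \<le> indet_code w"

definition less_indet :: "indet \<Rightarrow> indet \<Rightarrow> bool" where
  "less_indet v w \<longleftrightarrow> indet_code v < indet_code w"

instance
  by standard (auto simp: less_eq_indet_def less_indet_def dest: indet_code_inject)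

end

type_synonym 'k ratfun = "((indet \<Rightarrow>\<^sub>0 nat) \<Rightarrow>\<^sub>0 'k) fract"

definition ind :: "indet \<Rightarrow> 'k::field ratfun" where
  "ind v = Fract (Poly_Mapping.single (Poly_Mapping.single v 1) 1) 1"

definition xi :: "face \<Rightarrow> 'k::field ratfun" where
  "xi f = (\<Prod>i | i \<in> {1..length f} \<and> coord f i = Star. ind (Qvar i))
        * (\<Prod>i | i \<in> {1..length f} \<and> coord f i = Zero. ind (Xvar i))
        * (\<Prod>i | i \<in> {1..length f} \<and> coord f i = One. ind (Yvar i))"


section \<open>Weighted boundary maps and Laplacians\<close>

text \<open>\<open>col_faces n k\<close> and \<open>row_faces n k\<close> list the bases of \<open>C\<^sub>k\<close> and \<open>C\<^bsub>k-1\<^esub>\<close>. The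
  latter is empty for \<open>k = 0\<close>, and the former is empty for \<open>k = n + 1\<close>; therefore the products
  below involving \<open>bd n 0\<close> and \<open>bd n (n + 1)\<close> are zero matrices of the correct size.\<close>

definition col_faces :: "nat \<Rightarrow> nat \<Rightarrow> face list" where
  "col_faces n k = filter (\<lambda>f. fdim f = k) (faces n)"

definition row_faces :: "nat \<Rightarrow> nat \<Rightarrow> face list" where
  "row_faces n k = filter (\<lambda>f. fdim f + 1 = k) (faces n)"

definition bd :: "nat \<Rightarrow> nat \<Rightarrow> 'k::field ratfun mat" where
  "bd n k = mat (length (row_faces n k)) (length (col_faces n k))
     (\<lambda>(i, j). let f = row_faces n k ! i; g = col_faces n k ! j
               in of_int (eps f g) * (xi g / xi f))"

definition cobd :: "nat \<Rightarrow> nat \<Rightarrow> 'k::field ratfun mat" where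
  "cobd n k = transpose_mat (bd n k)"

definition L_ud :: "nat \<Rightarrow> nat \<Rightarrow> 'k::field ratfun mat" where
  "L_ud n k = bd n (k + 1) * cobd n (k + 1)"

definition L_du :: "nat \<Rightarrow> nat \<Rightarrow> 'k::field ratfun mat" where
  "L_du n k = cobd n k * bd n k"

definition L_tot :: "nat \<Rightarrow> nat \<Rightarrow> 'k::field ratfun mat" where
  "L_tot n k = L_ud n k + L_du n k"


section \<open>Spectra and their generating functions\<close>

text \<open>Eigenvalues are taken in an algebraic closure, with algebraic multiplicity.\<close>

definition spec :: "'a::field mat \<Rightarrow> 'a alg_closure multiset" where
  "spec A = proots (char_poly (map_mat to_ac A))"

text \<open>The formal exponentials \<open>r\<^sup>\<lambda>\<close> are the basis elements of the integral group ring of the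
  additive group of the field of eigenvalues; \<open>t\<close> is a polynomial variable over that ring.\<close>

type_synonym 'k genfun = "('k ratfun alg_closure \<Rightarrow>\<^sub>0 int) poly"

definition rexp :: "'a \<Rightarrow> ('a::comm_monoid_add \<Rightarrow>\<^sub>0 int)" where
  "rexp l = Poly_Mapping.single l 1"

definition E_gen :: "nat \<Rightarrow> (nat \<Rightarrow> nat \<Rightarrow> 'k::field ratfun mat) \<Rightarrow> 'k genfun" where
  "E_gen n L = (\<Sum>k = 0..n. \<Sum>l \<in># spec (L n k). monom (rexp l) k)"

definition E_tot :: "nat \<Rightarrow> 'k::field genfun" where
  "E_tot n = E_gen n L_tot"

definition E_ud :: "nat \<Rightarrow> 'k::field genfun" where
  "E_ud n = E_gen n L_ud"

definition t_var :: "'k::field genfun" where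
  "t_var = monom 1 1"

definition u_wt :: "nat \<Rightarrow> 'k::field ratfun" where
  "u_wt k = ind (Qvar k) ^ 2 / ind (Xvar k) ^ 2 + ind (Qvar k) ^ 2 / ind (Yvar k) ^ 2"

definition ru :: "nat \<Rightarrow> 'k::field genfun" where
  "ru k = [: rexp (to_ac (u_wt k)) :]"

definition esym :: "nat \<Rightarrow> nat \<Rightarrow> 'k::field genfun" where
  "esym n j = (\<Sum>S | S \<subseteq> {1..n} \<and> card S = j. \<Prod>k\<in>S. ru k)"

text \<open>Equality up to terms not involving \<open>r\<close>, i.e. up to the terms \<open>c t\<^sup>k r\<^sup>0\<close>.\<close>

definition eq_upto_const :: "'k::field genfun \<Rightarrow> 'k genfun \<Rightarrow> bool" (infix "\<doteq>" 50) where
  "p \<doteq> q \<longleftrightarrow>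
    (\<forall>k l. l \<noteq> 0 \<longrightarrow> Poly_Mapping.lookup (coeff p k) l = Poly_Mapping.lookup (coeff q k) l)"

end

theory Submission
  imports Defs
begin

text \<open>The cube is a product of intervals, and everything follows from this. Splitting off the first
  coordinate writes the weighted boundary as \<open>D = \<sigma> \<otimes> D' + d \<otimes> 1\<close>, where \<open>d\<close> is the boundary of an
  interval, \<open>D'\<close> that of the remaining cube, and \<open>\<sigma>\<close> is \<open>- 1\<close> on the edge and \<open>1\<close> on the two end
  points. Since \<open>\<sigma>\<close> is an involution that anticommutes with \<open>d\<close>, the mixed terms in
  \<open>D D\<^sup>T + D\<^sup>T D\<close> cancel: the total Laplacian is a sum of interval Laplacians, each acting on its own
  coordinate (lemma \<open>cube_lap_Cons\<close>). The same cancellation gives \<open>D D = 0\<close>.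

  With \<open>a = - q\<^sub>i / x\<^sub>i\<close> and \<open>b = q\<^sub>i / y\<^sub>i\<close>, the Laplacian of the \<open>i\<close>-th interval kills \<open>(b, - a)\<close>, and
  it multiplies \<open>(a, b)\<close> and the edge by \<open>a\<^sup>2 + b\<^sup>2 = u\<^sub>i\<close>. As \<open>u\<^sub>i \<noteq> 0\<close> in every characteristic, these
  three vectors form a basis, and products of them diagonalise the total Laplacian of the cube. The
  products are labelled by faces, with dimensions respected, and the face \<open>g\<close> belongs to the sum of
  the \<open>u\<^sub>i\<close> over all \<open>i\<close> with \<open>g\<^sub>i \<noteq> 0\<close> (lemma \<open>spec_L_tot\<close>). Summing over all faces, each
  coordinate contributes the factor \<open>1 + r\<^bsup>u\<^esup> + t r\<^bsup>u\<^esup>\<close> for \<open>u = u\<^sub>i\<close>.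

  A symmetric matrix over a general field need not be diagonalisable; therefore the up-down spectrum
  is found from characteristic polynomials. The up-down and down-up Laplacians have product zero, so, up to a power of the variable, the product of their characteristic
  polynomials is that of the total Laplacian. Moreover \<open>\<partial>\<^sup>T \<partial>\<close> and \<open>\<partial> \<partial>\<^sup>T\<close> have the same nonzero
  eigenvalues with multiplicity. Hence, away from the eigenvalue \<open>0\<close>, the total spectrum in dimension
  \<open>k\<close> consists of the up-down spectra in dimensions \<open>k\<close> and \<open>k - 1\<close>, that is,
  \<open>(1 + t) E\<^sup>u\<^sup>d \<doteq> E\<^sup>t\<^sup>o\<^sup>t\<close>. Expanding the product formula gives
  \<open>E\<^sup>t\<^sup>o\<^sup>t = 1 + (1 + t) \<Sum>\<^sub>j (1 + t)\<^bsup>j-1\<^esup> e\<^sub>j\<close>, and \<open>1 + t\<close> can be cancelled.\<close>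

section \<open>Characteristic polynomials of products and sums\<close>

lemma comm_ring_hom_const_poly: "comm_ring_hom (\<lambda>c::'a::comm_ring_1. [:c:])"
  by unfold_locales (auto simp: one_pCons)

lemma char_poly_matrix_eq:
  fixes A :: "'a::comm_ring_1 mat"
  assumes "A \<in> carrier_mat n n"
  shows "char_poly_matrix A = [:0, 1:] \<cdot>\<^sub>m 1\<^sub>m n + - map_mat (\<lambda>c. [:c:]) A"
  using assms by (auto simp: char_poly_matrix_def)

text \<open>Both sides are determinants of products of block matrices with the common factor
  \<open>M = (x, A; B, 1)\<close>: column operations turn \<open>M\<close> into a block triangular matrix with diagonal
  \<open>x - A B, 1\<close>, and row operations turn it into one with diagonal \<open>x, x - B A\<close>, at the cost of
  a factor \<open>x\<^sup>n\<close>.\<close>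

lemma char_poly_mult_commute:
  fixes A B :: "'a::field mat"
  assumes A: "A \<in> carrier_mat m n" and B: "B \<in> carrier_mat n m"
  shows "[:0, 1:] ^ n * char_poly (A * B) = [:0, 1:] ^ m * char_poly (B * A)"
proof -
  interpret C: comm_ring_hom "\<lambda>c::'a. [:c:]" by (rule comm_ring_hom_const_poly)
  let ?x = "[:0, 1:] :: 'a poly"
  define A' B' where "A' = C.mat_hom A" and "B' = C.mat_hom B"
  have A': "A' \<in> carrier_mat m n" and B': "B' \<in> carrier_mat n m"
    using A B by (auto simp: A'_def B'_def)
  have chiAB: "char_poly_matrix (A * B) = ?x \<cdot>\<^sub>m 1\<^sub>m m + - (A' * B')"
    using char_poly_matrix_eq[of "A * B" m] A B by (simp add: A'_def B'_def C.mat_hom_mult)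
  have chiBA: "char_poly_matrix (B * A) = - (B' * A') + ?x \<cdot>\<^sub>m 1\<^sub>m n"
    using char_poly_matrix_eq[of "B * A" n] A B
    by (simp add: A'_def B'_def C.mat_hom_mult comm_add_mat[of _ n n])
  define M where "M = four_block_mat (?x \<cdot>\<^sub>m 1\<^sub>m m) A' B' (1\<^sub>m n)"
  define U where "U = four_block_mat (1\<^sub>m m) (0\<^sub>m m n) (- B') (1\<^sub>m n)"
  define V where "V = four_block_mat (1\<^sub>m m) (0\<^sub>m m n) (- B') (?x \<cdot>\<^sub>m 1\<^sub>m n)"
  have carr: "M \<in> carrier_mat (m + n) (m + n)" "U \<in> carrier_mat (m + n) (m + n)"
    "V \<in> carrier_mat (m + n) (m + n)"
    using A' B' by (auto simp: M_def U_def V_def)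
  have "M * U = four_block_mat (char_poly_matrix (A * B)) A' (0\<^sub>m n m) (1\<^sub>m n)"
    unfolding M_def U_def chiAB using A' B'
    by (subst mult_four_block_mat[of _ m m _ n _ n _ _ m _ n])
      (auto intro!: cong_four_block_mat)
  then have MU: "det M * det U = char_poly (A * B)"
    using A B A' carr
    by (simp add: det_four_block_mat_lower_left_zero[of _ m _ n] char_poly_def flip: det_mult)
  have "V * M = four_block_mat (?x \<cdot>\<^sub>m 1\<^sub>m m) A' (0\<^sub>m n m) (char_poly_matrix (B * A))"
    unfolding M_def V_def chiBA using A' B'
    by (subst mult_four_block_mat[of _ m m _ n _ n _ _ m _ n])
      (auto intro!: cong_four_block_mat)
  then have VM: "det V * det M = ?x ^ m * char_poly (B * A)"
    using A B A' carr
    by (simp add: det_four_block_mat_lower_left_zero[of _ m _ n] char_poly_def flip: det_mult)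
  have "det U = 1" "det V = ?x ^ n"
    using B' by (simp_all add: U_def V_def det_four_block_mat_upper_right_zero[of _ m _ n])
  with MU VM show ?thesis by simp
qed

text \<open>If \<open>A B = 0\<close>, then \<open>(x - A) (x - B) = x (x - (A + B))\<close>; take determinants.\<close>

lemma char_poly_add_if_mult_eq_0:
  fixes A B :: "'a::field mat"
  assumes A: "A \<in> carrier_mat n n" and B: "B \<in> carrier_mat n n" and AB: "A * B = 0\<^sub>m n n"
  shows "char_poly A * char_poly B = [:0, 1:] ^ n * char_poly (A + B)"
proof -
  interpret C: comm_ring_hom "\<lambda>c::'a. [:c:]" by (rule comm_ring_hom_const_poly)
  let ?x = "[:0, 1:] :: 'a poly"
  define A' B' where "A' = C.mat_hom A" and "B' = C.mat_hom B"
  have A': "A' \<in> carrier_mat n n" and B': "B' \<in> carrier_mat n n"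
    using A B by (auto simp: A'_def B'_def)
  have "A' * B' = C.mat_hom (A * B)"
    using A B by (simp add: A'_def B'_def C.mat_hom_mult)
  also have "\<dots> = 0\<^sub>m n n"
    by (rule eq_matI) (auto simp: AB)
  finally have "(?x \<cdot>\<^sub>m 1\<^sub>m n + - A') * (?x \<cdot>\<^sub>m 1\<^sub>m n + - B') = ?x \<cdot>\<^sub>m (?x \<cdot>\<^sub>m 1\<^sub>m n + - (A' + B'))"
    using A' B'
    by (auto simp: add_mult_distrib_mat[of _ n n _ _ n] mult_add_distrib_mat[of _ n n _ n]
        mult_smult_assoc_mat[of _ n n _ n] mult_smult_distrib[of _ n n _ n] algebra_simps)
  moreover have "A' + B' = C.mat_hom (A + B)"
    using A B by (auto simp: A'_def B'_def)
  ultimately have "char_poly_matrix A * char_poly_matrix B = ?x \<cdot>\<^sub>m char_poly_matrix (A + B)"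
    using A B by (simp add: char_poly_matrix_eq[of _ n] A'_def B'_def)
  from arg_cong[OF this, of det] show ?thesis
    using A B by (simp add: char_poly_def det_mult[of _ n] det_smult carrier_matD(2)[of _ n n])
qed

lemma comm_ring_hom_to_ac: "comm_ring_hom (to_ac :: 'a::field \<Rightarrow> _)"
  by unfold_locales auto

lemma spec_eq_proots:
  assumes "A \<in> carrier_mat n n"
  shows "spec A = proots (map_poly to_ac (char_poly A))"
proof -
  interpret comm_ring_hom "to_ac :: 'a \<Rightarrow> _" by (rule comm_ring_hom_to_ac)
  show ?thesis using char_poly_hom[OF assms] by (simp add: spec_def)
qed

lemma char_poly_nonzero:
  fixes A :: "'a::field mat"
  assumes "A \<in> carrier_mat n n"
  shows "char_poly A \<noteq> 0"
  using degree_monic_char_poly[OF assms] by auto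

lemma spec_0_dim:
  assumes "A \<in> carrier_mat 0 0"
  shows "spec A = {#}"
  using assms by (simp add: spec_eq_proots[OF assms] char_poly_def map_poly_1')

lemma proots_power_x_mult:
  fixes p :: "'a::idom poly"
  assumes "p \<noteq> 0" "l \<noteq> 0"
  shows "count (proots ([:0, 1:] ^ n * p)) l = count (proots p) l"
  using assms by (simp add: proots_mult proots_power)

lemma count_spec_add_if_mult_eq_0:
  fixes A B :: "'a::field mat"
  assumes A: "A \<in> carrier_mat n n" and B: "B \<in> carrier_mat n n" and AB: "A * B = 0\<^sub>m n n"
    and l: "l \<noteq> 0"
  shows "count (spec (A + B)) l = count (spec A) l + count (spec B) l"
proof -
  interpret comm_ring_hom "to_ac :: 'a \<Rightarrow> _" by (rule comm_ring_hom_to_ac)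
  interpret P: map_poly_comm_ring_hom "to_ac :: 'a \<Rightarrow> _" ..
  let ?h = "map_poly (to_ac :: 'a \<Rightarrow> _)"
  have nz: "?h (char_poly M) \<noteq> 0" if "M \<in> carrier_mat n n" for M
    using char_poly_nonzero[OF that] by (simp add: map_poly_eq_0_iff)
  have "?h (char_poly A) * ?h (char_poly B) = [:0, 1:] ^ n * ?h (char_poly (A + B))"
    using arg_cong[OF char_poly_add_if_mult_eq_0[OF A B AB], of ?h]
    by (simp add: P.hom_mult P.hom_power)
  note arg_cong[OF this, of "\<lambda>p. count (proots p) l"]
  then show ?thesis
    using A B nz[OF A] nz[OF B] nz[of "A + B"] l
    by (simp add: spec_eq_proots[of _ n] proots_mult proots_power del: count_proots)
qed

lemma count_spec_mult_commute:
  fixes A B :: "'a::field mat"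
  assumes A: "A \<in> carrier_mat m n" and B: "B \<in> carrier_mat n m" and l: "l \<noteq> 0"
  shows "count (spec (A * B)) l = count (spec (B * A)) l"
proof -
  interpret comm_ring_hom "to_ac :: 'a \<Rightarrow> _" by (rule comm_ring_hom_to_ac)
  interpret P: map_poly_comm_ring_hom "to_ac :: 'a \<Rightarrow> _" ..
  let ?h = "map_poly (to_ac :: 'a \<Rightarrow> _)"
  have nz: "?h (char_poly M) \<noteq> 0" if "M \<in> carrier_mat k k" for M k
    using char_poly_nonzero[OF that] by (simp add: map_poly_eq_0_iff)
  have "[:0, 1:] ^ n * ?h (char_poly (A * B)) = [:0, 1:] ^ m * ?h (char_poly (B * A))"
    using arg_cong[OF char_poly_mult_commute[OF A B], of ?h]
    by (simp add: P.hom_mult P.hom_power)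
  note arg_cong[OF this, of "\<lambda>p. count (proots p) l"]
  then show ?thesis
    using A B nz[of "A * B" m] nz[of "B * A" n] l
    by (simp add: spec_eq_proots[of "A * B" m] spec_eq_proots[of "B * A" n] proots_power_x_mult
      del: count_proots)
qed

text \<open>It suffices to give a right inverse of the matrix \<open>P\<close> of eigenvectors, because square matrices
  that are inverse on one side are inverse on both.\<close>

lemma spec_diagonalisable:
  fixes A :: "'a::field mat"
  assumes carr: "A \<in> carrier_mat n n" "P \<in> carrier_mat n n" "Q \<in> carrier_mat n n"
    and PQ: "P * Q = 1\<^sub>m n" and AP: "A * P = P * mat n n (\<lambda>(i, j). if i = j then d i else 0)"
  shows "spec A = image_mset (\<lambda>i. to_ac (d i)) (mset [0..<n])"
proof -
  interpret comm_ring_hom "to_ac :: 'a \<Rightarrow> _" by (rule comm_ring_hom_to_ac)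
  interpret P: map_poly_comm_ring_hom "to_ac :: 'a \<Rightarrow> _" ..
  let ?D = "mat n n (\<lambda>(i, j). if i = j then d i else 0)"
  have "A = A * (P * Q)" using carr PQ by simp
  also have "\<dots> = P * ?D * Q" using carr by (simp add: AP flip: assoc_mult_mat[of _ n n _ n _ n])
  finally have "similar_mat A ?D"
    using carr PQ mat_mult_left_right_inverse[OF carr(2,3) PQ]
    by (intro similar_matI[of _ _ P Q n]) auto
  then have "char_poly A = char_poly ?D" by (rule char_poly_similar)
  also have "\<dots> = (\<Prod>i\<leftarrow>[0..<n]. [:- d i, 1:])"
    by (subst char_poly_upper_triangular[of _ n])
      (auto simp: diag_mat_def upper_triangular_def intro!: arg_cong[of _ _ prod_list])
  finally have "map_poly to_ac (char_poly A) = (\<Prod>i\<leftarrow>[0..<n]. [:- to_ac (d i), 1:])"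
    by (simp add: P.hom_prod_list o_def)
  moreover have "proots (\<Prod>x\<leftarrow>xs. [:- to_ac (d x), 1:]) = image_mset (\<lambda>x. to_ac (d x)) (mset xs)"
    for xs
  proof (induction xs)
    case (Cons x xs)
    have "(\<Prod>x\<leftarrow>xs. [:- to_ac (d x), 1:]) \<noteq> 0" by (auto simp: prod_list_zero_iff)
    with Cons show ?case by (simp add: proots_mult del: mult_pCons_left)
  qed simp
  ultimately show ?thesis
    using carr by (simp add: spec_eq_proots[of _ n])
qed

section \<open>The boundary map of a cube with arbitrary edge weights\<close>

lemma finite_faces [simp]: "finite {f::face. length f = n}"
  using set_faces[of n] by (metis List.finite_set)

lemma sum_faces_Suc:
  fixes F :: "face \<Rightarrow> 'a::comm_monoid_add"
  shows "(\<Sum>f | length f = Suc n. F f) =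
    (\<Sum>f | length f = n. F (Zero # f)) + (\<Sum>f | length f = n. F (One # f))
      + (\<Sum>f | length f = n. F (Star # f))"
proof -
  have split: "{f::face. length f = Suc n} = (#) Zero ` {f. length f = n} \<union> (#) One ` {f. length f = n}
      \<union> (#) Star ` {f. length f = n}"
    by (auto simp: length_Suc_conv image_iff) (metis csym.exhaust)
  show ?thesis
    unfolding split
    by (subst sum.union_disjoint; (subst sum.union_disjoint)?) (auto simp: sum.reindex)
qed

text \<open>The weight \<open>w i a\<close> is the entry of the boundary of the \<open>i\<close>-th interval at its end point \<open>a\<close>, sign
  included. In all functions below, the argument \<open>i\<close> is the number of the first coordinate of the
  faces, so that a recursion on faces can shift the weights.\<close>

definition edge_bd :: "(nat \<Rightarrow> csym \<Rightarrow> 'a::field) \<Rightarrow> nat \<Rightarrow> csym \<Rightarrow> csym \<Rightarrow> 'a" where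
  "edge_bd w i a b = (if a \<noteq> Star \<and> b = Star then w i a else 0)"

definition parity :: "csym \<Rightarrow> 'a::field" where
  "parity a = (if a = Star then - 1 else 1)"

text \<open>The matrix \<open>\<sigma> \<otimes> D' + d \<otimes> 1\<close>, where \<open>\<sigma>\<close> is the diagonal matrix with entries \<open>parity\<close> and \<open>d\<close> is
  \<open>edge_bd\<close>: every direction of the face changes the sign of the incidences in all later coordinates.\<close>

fun cube_bd :: "(nat \<Rightarrow> csym \<Rightarrow> 'a::field) \<Rightarrow> nat \<Rightarrow> face \<Rightarrow> face \<Rightarrow> 'a" where
  "cube_bd w i (a # f) (b # g) =
     (if a = b then parity a * cube_bd w (Suc i) f g else 0) + (if f = g then edge_bd w i a b else 0)"
| "cube_bd w i _ _ = 0"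

abbreviation edge_eig :: "(nat \<Rightarrow> csym \<Rightarrow> 'a::field) \<Rightarrow> nat \<Rightarrow> 'a" where
  "edge_eig w i \<equiv> w i Zero ^ 2 + w i One ^ 2"

text \<open>The entries of \<open>D D\<^sup>T + D\<^sup>T D\<close> for the boundary \<open>D\<close> in all dimensions at once.\<close>

definition cube_lap :: "(nat \<Rightarrow> csym \<Rightarrow> 'a::field) \<Rightarrow> nat \<Rightarrow> face \<Rightarrow> face \<Rightarrow> 'a" where
  "cube_lap w i f h = (\<Sum>g | length g = length f. cube_bd w i f g * cube_bd w i h g
     + cube_bd w i g f * cube_bd w i g h)"

definition edge_lap :: "(nat \<Rightarrow> csym \<Rightarrow> 'a::field) \<Rightarrow> nat \<Rightarrow> csym \<Rightarrow> csym \<Rightarrow> 'a" where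
  "edge_lap w i a b = (if a = Star \<or> b = Star then (if a = b then edge_eig w i else 0)
     else w i a * w i b)"

text \<open>The mixed terms are \<open>\<sigma> d\<^sup>T + d\<^sup>T \<sigma>\<close> times \<open>D'\<close> and \<open>\<sigma> d + d \<sigma>\<close> times its transpose; they vanish
  because \<open>d\<close> and \<open>d\<^sup>T\<close> pass between the edge and its end points, where \<open>\<sigma>\<close> has opposite signs.\<close>

lemma cube_lap_Cons:
  assumes "length f = length h"
  shows "cube_lap w i (a # f) (b # h) =
    (if a = b then cube_lap w (Suc i) f h else 0) + (if f = h then edge_lap w i a b else 0)"
proof -
  have aux: "length h = length f" using assms by simp
  show ?thesis
   by (cases a; cases b)
    (auto simp: cube_lap_def sum_faces_Suc parity_def edge_bd_def edge_lap_def sum.distrib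
      sum_distrib_left sum_subtractf if_distrib[of "\<lambda>x. x * _"] if_distrib[of "\<lambda>x. _ * x"]
      aux algebra_simps power2_eq_square sum_negf
      cong: if_cong)
qed

text \<open>The square of \<open>\<sigma> \<otimes> D' + d \<otimes> 1\<close> is \<open>\<sigma>\<^sup>2 \<otimes> D'\<^sup>2 + (\<sigma> d + d \<sigma>) \<otimes> D' + d\<^sup>2 \<otimes> 1\<close>, where the
  last two terms are zero and the first one is zero by induction.\<close>

lemma cube_bd_cube_bd:
  assumes "length f = n" "length h = n"
  shows "(\<Sum>g | length g = n. cube_bd w i f g * cube_bd w i g h) = 0"
  using assms
proof (induction n arbitrary: i f h)
  case 0
  then show ?case by simp
next
  case (Suc n)
  obtain a f' b h' where [simp]: "f = a # f'" "h = b # h'" "length f' = n" "length h' = n"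
    using Suc.prems by (auto simp: length_Suc_conv)
  show ?case
    using Suc.IH[of f' h' "Suc i"]
    by (cases a; cases b)
      (auto simp: sum_faces_Suc parity_def edge_bd_def sum.distrib sum_subtractf sum_negf
        if_distrib[of "\<lambda>x. x * _"] if_distrib[of "\<lambda>x. _ * x"] algebra_simps
        simp flip: sum_distrib_left sum_distrib_right cong: if_cong)
qed

lemma dir_Nil [simp]: "dir [] = {}"
  by (simp add: dir_def)

lemma finite_dir [simp]: "finite (dir f)"
  by (simp add: dir_def)

lemma dir_Cons: "dir (a # f) = (if a = Star then {1} else {}) \<union> Suc ` dir f"
proof (rule Set.set_eqI)
  fix i
  show "i \<in> dir (a # f) \<longleftrightarrow> i \<in> (if a = Star then {1} else {}) \<union> Suc ` dir f"
    by (cases i; cases "i - 1") (auto simp: dir_def coord_def image_iff)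
qed

lemma fdim_Nil [simp]: "fdim [] = 0"
  by (simp add: fdim_def)

lemma fdim_Cons [simp]: "fdim (a # f) = (if a = Star then Suc (fdim f) else fdim f)"
proof -
  have "1 \<notin> Suc ` dir f" by (auto simp: dir_def)
  then show ?thesis by (simp add: fdim_def dir_Cons card_image)
qed

lemma cube_bd_eq_0: "fdim g \<noteq> Suc (fdim f) \<Longrightarrow> cube_bd w i f g = 0"
  by (induction w i f g rule: cube_bd.induct) (auto simp: edge_bd_def split: if_splits)

section \<open>Eigenvectors of the total Laplacian\<close>

text \<open>The column \<open>b\<close> is an eigenvector of the interval Laplacian: \<open>b = Zero\<close> labels the kernel, \<open>b = One\<close>
  the eigenvalue \<open>edge_eig w i\<close> on the end points, and \<open>b = Star\<close> the edge itself.\<close>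

fun edge_eigvec :: "(nat \<Rightarrow> csym \<Rightarrow> 'a::field) \<Rightarrow> nat \<Rightarrow> csym \<Rightarrow> csym \<Rightarrow> 'a" where
  "edge_eigvec w i Zero Zero = w i One"
| "edge_eigvec w i One Zero = - w i Zero"
| "edge_eigvec w i Zero One = w i Zero"
| "edge_eigvec w i One One = w i One"
| "edge_eigvec w i Star Star = 1"
| "edge_eigvec w i _ _ = 0"

text \<open>The two eigenvectors on the end points are orthogonal with the same square norm \<open>edge_eig w i\<close>, so
  the inverse of the eigenvector matrix is its transpose up to this norm.\<close>

definition edge_coeigvec :: "(nat \<Rightarrow> csym \<Rightarrow> 'a::field) \<Rightarrow> nat \<Rightarrow> csym \<Rightarrow> csym \<Rightarrow> 'a" where
  "edge_coeigvec w i a b = edge_eigvec w i b a / (if a = Star then 1 else edge_eig w i)"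

fun face_prod :: "(nat \<Rightarrow> csym \<Rightarrow> csym \<Rightarrow> 'a::field) \<Rightarrow> nat \<Rightarrow> face \<Rightarrow> face \<Rightarrow> 'a" where
  "face_prod p i (a # f) (b # g) = p i a b * face_prod p (Suc i) f g"
| "face_prod p i _ _ = 1"

lemma eigvec_coeigvec:
  fixes w :: "nat \<Rightarrow> csym \<Rightarrow> 'a::field"
  assumes "\<And>i. edge_eig w i \<noteq> 0" "length f = n" "length g = n"
  shows "(\<Sum>h | length h = n. face_prod (edge_eigvec w) i f h * face_prod (edge_coeigvec w) i h g)
    = (if f = g then 1 else 0)"
  using assms(2,3)
proof (induction n arbitrary: i f g)
  case 0
  then show ?case by simp
next
  case (Suc n)
  obtain a f' b g' where [simp]: "f = a # f'" "g = b # g'" "length f' = n" "length g' = n"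
    using Suc.prems by (auto simp: length_Suc_conv)
  \<comment> \<open>The contribution of one value of the first coordinate of \<open>h\<close>.\<close>
  have fact: "(\<Sum>h | length h = n. c * face_prod (edge_eigvec w) (Suc i) f' h
        * (d * face_prod (edge_coeigvec w) (Suc i) h g'))
      = c * d * (if f' = g' then 1 else 0)" for c d
    by (simp flip: Suc.IH[of f' g' "Suc i"] add: sum_distrib_left mult_ac)
  have "(\<Sum>h | length h = Suc n. face_prod (edge_eigvec w) i f h * face_prod (edge_coeigvec w) i h g)
    = (edge_eigvec w i a Zero * edge_coeigvec w i Zero b
      + edge_eigvec w i a One * edge_coeigvec w i One b
      + edge_eigvec w i a Star * edge_coeigvec w i Star b) * (if f' = g' then 1 else 0)"
    unfolding sum_faces_Suc by (simp add: fact)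
  also have "edge_eigvec w i a Zero * edge_coeigvec w i Zero b
      + edge_eigvec w i a One * edge_coeigvec w i One b
      + edge_eigvec w i a Star * edge_coeigvec w i Star b = (if a = b then 1 else 0)"
    using assms(1)[of i]
    by (cases a; cases b)
      (simp_all add: edge_coeigvec_def power2_eq_square add.commute flip: add_divide_distrib)
  finally show ?case by simp
qed

lemma eigvec_eq_0:
  "length f = length g \<Longrightarrow> fdim f \<noteq> fdim g \<Longrightarrow> face_prod (edge_eigvec w) i f g = 0"
proof (induction f g arbitrary: i rule: list_induct2)
  case (Cons a f b g)
  then show ?case by (cases a; cases b) auto
qed simp

fun cube_eig :: "(nat \<Rightarrow> csym \<Rightarrow> 'a::field) \<Rightarrow> nat \<Rightarrow> face \<Rightarrow> 'a" where
  "cube_eig w i (b # g) = (if b = Zero then 0 else edge_eig w i) + cube_eig w (Suc i) g"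
| "cube_eig w i [] = 0"

lemma edge_lap_eigvec:
  "edge_lap w i a Zero * edge_eigvec w i Zero b + edge_lap w i a One * edge_eigvec w i One b
    + edge_lap w i a Star * edge_eigvec w i Star b
    = (if b = Zero then 0 else edge_eig w i) * edge_eigvec w i a b"
  by (cases a; cases b) (auto simp: edge_lap_def algebra_simps power2_eq_square)

lemma cube_lap_eigvec:
  assumes "length f = n" "length g = n"
  shows "(\<Sum>h | length h = n. cube_lap w i f h * face_prod (edge_eigvec w) i h g)
    = cube_eig w i g * face_prod (edge_eigvec w) i f g"
  using assms
proof (induction n arbitrary: i f g)
  case 0
  then show ?case by (simp add: cube_lap_def)
next
  case (Suc n)
  obtain a f' b g' where [simp]: "f = a # f'" "g = b # g'" "length f' = n" "length g' = n"
    using Suc.prems by (auto simp: length_Suc_conv)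
  let ?P = "face_prod (edge_eigvec w)"
  \<comment> \<open>The Laplacian acts either on the later coordinates, and then it keeps \<open>a\<close>, or on the first one,
    and then it keeps \<open>f'\<close>.\<close>
  have step: "(\<Sum>h | length h = n. cube_lap w i f (c # h) * ?P i (c # h) g)
    = (if a = c then edge_eigvec w i c b * (cube_eig w (Suc i) g' * ?P (Suc i) f' g') else 0)
      + edge_lap w i a c * edge_eigvec w i c b * ?P (Suc i) f' g'" for c
  proof -
    have "(\<Sum>h | length h = n. cube_lap w i f (c # h) * ?P i (c # h) g) =
      (\<Sum>h | length h = n.
        (if a = c then edge_eigvec w i c b * (cube_lap w (Suc i) f' h * ?P (Suc i) h g') else 0)
        + (if f' = h then edge_lap w i a c * edge_eigvec w i c b * ?P (Suc i) f' g' else 0))"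
      by (rule sum.cong) (auto simp: cube_lap_Cons algebra_simps)
    then show ?thesis
      by (simp add: sum.distrib Suc.IH flip: sum_distrib_left)
  qed
  have "(\<Sum>h | length h = Suc n. cube_lap w i f h * ?P i h g)
    = edge_eigvec w i a b * (cube_eig w (Suc i) g' * ?P (Suc i) f' g')
      + (edge_lap w i a Zero * edge_eigvec w i Zero b + edge_lap w i a One * edge_eigvec w i One b
    + edge_lap w i a Star * edge_eigvec w i Star b) * ?P (Suc i) f' g'"
    unfolding sum_faces_Suc step by (cases a) (simp_all add: algebra_simps)
  then show ?case
    unfolding edge_lap_eigvec by (simp add: algebra_simps)
qed

section \<open>Incidence signs and face weights\<close>

lemma face_le_simps [simp]: "face_le [] []" "face_le (a # f) (b # g) \<longleftrightarrow> a \<le> b \<and> face_le f g"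
  by (auto simp: face_le_def)

lemma csym_le_iff: "(a::csym) \<le> b \<longleftrightarrow> a = b \<or> b = Star"
  by (simp add: less_eq_csym_def)

lemma face_le_dir_subset: "face_le f g \<Longrightarrow> dir f \<subseteq> dir g"
  unfolding face_le_def
  by (induction f g rule: list_all2_induct) (auto simp: dir_Cons csym_le_iff)

lemma face_le_eq_if_fdim_eq: "face_le f g \<Longrightarrow> fdim f = fdim g \<Longrightarrow> f = g"
  unfolding face_le_def
proof (induction f g rule: list_all2_induct)
  case (Cons a f b g)
  have "fdim f \<le> fdim g"
    using Cons.hyps face_le_dir_subset[of f g] by (simp add: face_le_def fdim_def card_mono)
  with Cons show ?case by (auto simp: csym_le_iff split: if_splits)
qed simp

text \<open>This names the removed direction \<open>c\<close> explicitly, in place of the definite description in the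
  definition of the sign.\<close>

lemma eps_eqI:
  assumes "face_le f g" "c \<in> dir g" "dir f = dir g - {c}"
  shows "eps f g = (- 1) ^ (card {b \<in> dir g. b \<le> c} + (if coord f c = Zero then 0 else 1))"
proof -
  have "(THE a. a \<in> dir g \<and> dir f = dir g - {a}) = c"
    using assms(2,3) by (intro the_equality) auto
  moreover have "fdim f + 1 = fdim g"
    using assms(2,3) card_Suc_Diff1[of "dir g" c] by (simp add: fdim_def)
  ultimately show ?thesis
    using assms(1) by (simp add: eps_def Let_def)
qed

text \<open>A new first coordinate shifts the removed direction by one. Its position among the directions of
  the larger face changes exactly if the new coordinate is itself a direction.\<close>

lemma eps_Cons_same: "eps (a # f) (a # g) = (if a = Star then - eps f g else eps f g)"
proof (cases "face_le f g \<and> fdim f + 1 = fdim g")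
  case False
  then have "eps f g = 0" "eps (a # f) (a # g) = 0" by (auto simp: eps_def)
  then show ?thesis by simp
next
  case True
  then have "card (dir g - dir f) = 1"
    using face_le_dir_subset[of f g] by (auto simp: fdim_def card_Diff_subset)
  then obtain c where "dir g - dir f = {c}" by (auto simp: card_1_singleton_iff)
  then have c: "c \<in> dir g" "dir f = dir g - {c}" using True face_le_dir_subset[of f g] by auto
  then have "c \<ge> 1" by (simp add: dir_def)
  have eq: "eps f g = (- 1) ^ (card {b \<in> dir g. b \<le> c} + (if coord f c = Zero then 0 else 1))"
    using eps_eqI[of f g c] True c by simp
  have "Suc c \<in> dir (a # g)" "dir (a # f) = dir (a # g) - {Suc c}"
    using c \<open>c \<ge> 1\<close> by (auto simp: dir_Cons)
  then have "eps (a # f) (a # g) = (- 1) ^ (card {b \<in> dir (a # g). b \<le> Suc c}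
      + (if coord (a # f) (Suc c) = Zero then 0 else 1))"
    using True by (intro eps_eqI) auto
  moreover have "coord (a # f) (Suc c) = coord f c"
    using \<open>c \<ge> 1\<close> by (cases c) (auto simp: coord_def)
  moreover have "{b \<in> dir (a # g). b \<le> Suc c}
    = (if a = Star then {1} else {}) \<union> Suc ` {b \<in> dir g. b \<le> c}"
    by (auto simp: dir_Cons)
  moreover have "1 \<notin> Suc ` {b \<in> dir g. b \<le> c}" by (auto simp: dir_def)
  ultimately show ?thesis by (auto simp: eq card_image)
qed

lemma zero_notin_dir [simp]: "0 \<notin> dir f"
  by (simp add: dir_def)

text \<open>If the first coordinates differ, only they can account for the removed direction. Its position
  is then 1, and the faces must agree in all other coordinates.\<close>

lemma eps_Cons_diff:
  assumes "a \<noteq> b"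
  shows "eps (a # f) (b # g) = (if b = Star \<and> f = g then (if a = Zero then - 1 else 1) else 0)"
proof (cases "b = Star \<and> f = g")
  case True
  have "face_le f f" by (simp add: face_le_def list_all2_refl)
  then have "eps (a # f) (b # g) = (- 1) ^ (card {c \<in> dir (b # g). c \<le> 1}
      + (if coord (a # f) 1 = Zero then 0 else 1))"
    using True assms by (intro eps_eqI) (auto simp: dir_Cons csym_le_iff image_iff)
  moreover have "{c \<in> dir (b # g). c \<le> 1} = {1}"
    using True by (auto simp: dir_Cons)
  ultimately show ?thesis using True by (simp add: coord_def)
next
  case False
  then show ?thesis
    using assms face_le_eq_if_fdim_eq[of f g] by (auto simp: eps_def csym_le_iff)
qed

definition indet_of :: "nat \<Rightarrow> csym \<Rightarrow> 'k::field ratfun" where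
  "indet_of i a = ind (case a of Zero \<Rightarrow> Xvar i | One \<Rightarrow> Yvar i | Star \<Rightarrow> Qvar i)"

fun xi_from :: "nat \<Rightarrow> face \<Rightarrow> 'k::field ratfun" where
  "xi_from i (a # f) = indet_of i a * xi_from (Suc i) f"
| "xi_from i [] = 1"

lemma xi_from_eq_prod: "xi_from i f = (\<Prod>j<length f. indet_of (i + j) (f ! j))"
  by (induction f arbitrary: i) (simp_all add: prod.lessThan_Suc_shift del: prod.lessThan_Suc)

lemma xi_eq_xi_from: "xi f = xi_from 1 f"
proof -
  have "xi f = (\<Prod>i = 1..length f. indet_of i (coord f i))"
    unfolding xi_def prod.inter_filter[OF finite_atLeastAtMost] prod.distrib[symmetric]
    by (rule prod.cong) (auto simp: indet_of_def split: csym.splits intro: csym.exhaust[of "coord f _"])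
  also have "\<dots> = xi_from 1 f"
    by (simp add: xi_from_eq_prod coord_def prod.atLeast1_atMost_eq)
  finally show ?thesis .
qed

lemma ind_nonzero: "(ind v :: 'k::field ratfun) \<noteq> 0"
  by (auto simp: ind_def Zero_fract_def eq_fract
      dest: arg_cong[of _ _ "\<lambda>p. Poly_Mapping.lookup p (Poly_Mapping.single v 1)"])

lemma ind_power: "(ind v ^ 2 :: 'k::field ratfun) = Fract (Poly_Mapping.single (Poly_Mapping.single v 2) 1) 1"
  by (simp add: ind_def power2_eq_square mult_single numeral_2_eq_2 flip: single_add)

lemma xi_from_nonzero: "xi_from i f \<noteq> 0"
  by (induction i f rule: xi_from.induct) (simp_all add: indet_of_def ind_nonzero)

definition cube_wt :: "nat \<Rightarrow> csym \<Rightarrow> 'k::field ratfun" where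
  "cube_wt i a = (if a = Zero then - 1 else 1) * (indet_of i Star / indet_of i a)"

lemma cube_wt_eq_u_wt: "edge_eig cube_wt i = u_wt i"
  by (simp add: cube_wt_def u_wt_def indet_of_def power_divide)

text \<open>The two squares are different monomials, so no cancellation occurs even in characteristic 2.\<close>

lemma ind_sq_add_nonzero:
  assumes "v \<noteq> v'"
  shows "(ind v ^ 2 + ind v' ^ 2 :: 'k::field ratfun) \<noteq> 0"
proof
  assume "(ind v ^ 2 + ind v' ^ 2 :: 'k ratfun) = 0"
  then have "Poly_Mapping.single (Poly_Mapping.single v (2::nat)) 1
      + Poly_Mapping.single (Poly_Mapping.single v' 2) (1::'k) = 0"
    by (simp add: ind_power Zero_fract_def eq_fract)
  from arg_cong[OF this, of "\<lambda>p. Poly_Mapping.lookup p (Poly_Mapping.single v 2)"]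
  have "Poly_Mapping.single v' (2::nat) = Poly_Mapping.single v 2"
    by (simp add: lookup_add lookup_single when_def split: if_splits)
  from arg_cong[OF this, of "\<lambda>p. Poly_Mapping.lookup p v"] show False
    using assms by (simp add: lookup_single when_def split: if_splits)
qed

lemma u_wt_nonzero: "(u_wt i :: 'k::field ratfun) \<noteq> 0"
proof -
  let ?X = "ind (Xvar i) :: 'k ratfun" and ?Y = "ind (Yvar i) :: 'k ratfun"
  have "u_wt i = ind (Qvar i) ^ 2 * (?X ^ 2 + ?Y ^ 2) / (?X ^ 2 * ?Y ^ 2)"
    by (simp add: u_wt_def ind_nonzero field_simps)
  then show ?thesis by (simp add: ind_nonzero ind_sq_add_nonzero)
qed

text \<open>If the first coordinates agree, their weights cancel in \<open>xi g / xi f\<close>. If they differ, only the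
  quotient of the first weights is left.\<close>

lemma weighted_eps_eq_cube_bd:
  "length f = length g \<Longrightarrow> of_int (eps f g) * (xi_from i g / xi_from i f) = cube_bd cube_wt i f g"
proof (induction f g arbitrary: i rule: list_induct2)
  case Nil
  then show ?case by (simp add: eps_def)
next
  case (Cons a f b g)
  show ?case
  proof (cases "a = b")
    case True
    then show ?thesis
      by (simp add: eps_Cons_same edge_bd_def parity_def indet_of_def ind_nonzero
          flip: Cons.IH[of "Suc i"])
  next
    case False
    then show ?thesis
      by (auto simp: eps_Cons_diff edge_bd_def cube_wt_def xi_from_nonzero)
  qed
qed

section \<open>The Laplacians as matrices indexed by faces\<close>

text \<open>Matrices whose rows and columns are indexed by lists of faces, so that products become sums over
  sets of faces.\<close>

definition face_mat :: "(face \<Rightarrow> face \<Rightarrow> 'a) \<Rightarrow> face list \<Rightarrow> face list \<Rightarrow> 'a mat" where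
  "face_mat F xs ys = mat (length xs) (length ys) (\<lambda>(i, j). F (xs ! i) (ys ! j))"

lemma face_mat_carrier [simp]: "face_mat F xs ys \<in> carrier_mat (length xs) (length ys)"
  by (simp add: face_mat_def)

lemma face_mat_cong:
  assumes "xs = xs'" "ys = ys'" "\<And>f g. f \<in> set xs' \<Longrightarrow> g \<in> set ys' \<Longrightarrow> F f g = G f g"
  shows "face_mat F xs ys = face_mat G xs' ys'"
  using assms by (auto simp: face_mat_def)

lemma face_mat_mult:
  fixes F G :: "face \<Rightarrow> face \<Rightarrow> 'a::comm_semiring_1"
  assumes "distinct ys"
  shows "face_mat F xs ys * face_mat G ys zs
    = face_mat (\<lambda>f h. \<Sum>g\<in>set ys. F f g * G g h) xs zs"
proof (rule eq_matI)
  fix i j assume "i < dim_row (face_mat (\<lambda>f h. \<Sum>g\<in>set ys. F f g * G g h) xs zs)"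
    "j < dim_col (face_mat (\<lambda>f h. \<Sum>g\<in>set ys. F f g * G g h) xs zs)"
  then show "(face_mat F xs ys * face_mat G ys zs) $$ (i, j)
    = face_mat (\<lambda>f h. \<Sum>g\<in>set ys. F f g * G g h) xs zs $$ (i, j)"
    by (simp add: face_mat_def scalar_prod_def sum.distinct_set_conv_list[OF assms]
        sum_list_sum_nth)
qed (auto simp: face_mat_def)

lemma face_mat_transpose: "transpose_mat (face_mat F xs ys) = face_mat (\<lambda>g f. F f g) ys xs"
  by (auto simp: face_mat_def)

lemma face_mat_add: "face_mat F xs ys + face_mat G xs ys = face_mat (\<lambda>f g. F f g + G f g) xs ys"
  by (auto simp: face_mat_def)

lemma face_mat_0: "face_mat (\<lambda>f g. 0) xs ys = 0\<^sub>m (length xs) (length ys)"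
  by (auto simp: face_mat_def)

lemma face_mat_1: "distinct xs \<Longrightarrow> face_mat (\<lambda>f g. if f = g then 1 else 0) xs xs = 1\<^sub>m (length xs)"
  by (auto simp: face_mat_def nth_eq_iff_index_eq)

lemma set_col_faces [simp]: "set (col_faces n k) = {f. length f = n \<and> fdim f = k}"
  by (auto simp: col_faces_def set_faces)

lemma set_row_faces [simp]: "set (row_faces n k) = {f. length f = n \<and> fdim f + 1 = k}"
  by (auto simp: row_faces_def set_faces)

lemma distinct_col_faces [simp]: "distinct (col_faces n k)"
  by (simp add: col_faces_def distinct_faces)

lemma distinct_row_faces [simp]: "distinct (row_faces n k)"
  by (simp add: row_faces_def distinct_faces)

lemma row_faces_Suc: "row_faces n (Suc k) = col_faces n k"
  by (simp add: row_faces_def col_faces_def)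

lemma row_faces_0: "row_faces n 0 = []"
  by (simp add: row_faces_def)

abbreviation weighted_bd :: "face \<Rightarrow> face \<Rightarrow> 'k::field ratfun" where
  "weighted_bd \<equiv> cube_bd cube_wt 1"

lemma bd_eq_face_mat: "bd n k = face_mat weighted_bd (row_faces n k) (col_faces n k)"
proof -
  have "length (row_faces n k ! i) = n" "length (col_faces n k ! j) = n"
    if "i < length (row_faces n k)" "j < length (col_faces n k)" for i j
    using nth_mem[OF that(1)] nth_mem[OF that(2)] by auto
  then show ?thesis
    by (intro eq_matI) (simp_all add: bd_def face_mat_def xi_eq_xi_from weighted_eps_eq_cube_bd
        del: times_divide_eq_right One_nat_def)
qed

lemma cobd_eq_face_mat:
  "cobd n k = face_mat (\<lambda>g f. weighted_bd f g) (col_faces n k) (row_faces n k)"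
  by (simp add: cobd_def bd_eq_face_mat face_mat_transpose)

text \<open>Incidences and entries of the eigenvector matrix vanish unless the dimensions fit. Hence sums over
  the faces of one dimension extend to all faces, where the recursions over the coordinates apply.\<close>

lemma sum_faces_fdim:
  fixes F :: "face \<Rightarrow> 'a::comm_monoid_add"
  assumes "\<And>f. length f = n \<Longrightarrow> \<not> P f \<Longrightarrow> F f = 0"
  shows "(\<Sum>f | length f = n \<and> P f. F f) = (\<Sum>f | length f = n. F f)"
  by (rule sum.mono_neutral_left) (use assms in auto)

lemma L_ud_eq_face_mat:
  "L_ud n k = face_mat (\<lambda>f h. \<Sum>g | length g = n. weighted_bd f g * weighted_bd h g)
     (col_faces n k) (col_faces n k)"
proof -
  have "(\<Sum>g | length g = n \<and> fdim g = Suc k. weighted_bd f g * weighted_bd h g)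
    = (\<Sum>g | length g = n. weighted_bd f g * weighted_bd h g :: 'a ratfun)"
    if "fdim f = k" for f h
    by (rule sum_faces_fdim) (use that in \<open>auto simp: cube_bd_eq_0\<close>)
  then show ?thesis
    by (simp add: L_ud_def bd_eq_face_mat cobd_eq_face_mat row_faces_Suc face_mat_mult)
      (auto intro!: face_mat_cong)
qed

lemma L_du_eq_face_mat:
  "L_du n k = face_mat (\<lambda>f h. \<Sum>g | length g = n. weighted_bd g f * weighted_bd g h)
     (col_faces n k) (col_faces n k)"
proof -
  have "(\<Sum>g | length g = n \<and> Suc (fdim g) = k. weighted_bd g f * weighted_bd g h)
    = (\<Sum>g | length g = n. weighted_bd g f * weighted_bd g h :: 'a ratfun)"
    if "fdim f = k" for f h
    by (rule sum_faces_fdim) (use that in \<open>auto simp: cube_bd_eq_0\<close>)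
  then show ?thesis
    by (simp add: L_du_def bd_eq_face_mat cobd_eq_face_mat face_mat_mult)
      (auto intro!: face_mat_cong)
qed

lemma L_tot_eq_face_mat:
  "L_tot n k = face_mat (cube_lap cube_wt 1) (col_faces n k) (col_faces n k)"
  by (simp add: L_tot_def L_ud_eq_face_mat L_du_eq_face_mat face_mat_add)
    (auto simp: cube_lap_def sum.distrib intro!: face_mat_cong)

lemma L_carrier:
  "L_ud n k \<in> carrier_mat (length (col_faces n k)) (length (col_faces n k))"
  "L_du n k \<in> carrier_mat (length (col_faces n k)) (length (col_faces n k))"
  by (simp_all add: L_ud_eq_face_mat L_du_eq_face_mat)

text \<open>The middle factor of \<open>\<partial> (\<partial>\<^sup>T \<partial>\<^sup>T) \<partial>\<close> is the transpose of \<open>\<partial> \<partial> = 0\<close>.\<close>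

lemma L_ud_mult_L_du:
  "(L_ud n k * L_du n k :: 'k::field ratfun mat) = 0\<^sub>m (length (col_faces n k)) (length (col_faces n k))"
proof -
  let ?r = "length (row_faces n k)" and ?c = "length (col_faces n k)"
    and ?d = "length (col_faces n (k + 1))"
  have carr: "(bd n (k + 1) :: 'k ratfun mat) \<in> carrier_mat ?c ?d"
    "(cobd n (k + 1) :: 'k ratfun mat) \<in> carrier_mat ?d ?c"
    "(cobd n k :: 'k ratfun mat) \<in> carrier_mat ?c ?r" "(bd n k :: 'k ratfun mat) \<in> carrier_mat ?r ?c"
    by (simp_all add: bd_eq_face_mat cobd_eq_face_mat flip: row_faces_Suc)
  have "(\<Sum>f | length f = n \<and> fdim f = k. weighted_bd f h * weighted_bd g f) = (0::'k ratfun)"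
    if "Suc (fdim g) = k" "length g = n" "length h = n" for g h
  proof -
    have "(\<Sum>f | length f = n \<and> fdim f = k. weighted_bd f h * weighted_bd g f)
      = (\<Sum>f | length f = n. weighted_bd g f * weighted_bd f h :: 'k ratfun)"
      by (subst sum_faces_fdim) (use that in \<open>auto simp: cube_bd_eq_0 mult.commute\<close>)
    then show ?thesis using cube_bd_cube_bd[OF that(2,3)] by simp
  qed
  then have "cobd n (k + 1) * cobd n k = (0\<^sub>m ?d ?r :: 'k ratfun mat)"
    by (simp add: cobd_eq_face_mat row_faces_Suc face_mat_mult flip: face_mat_0)
      (auto intro!: face_mat_cong)
  moreover have "L_ud n k * L_du n k = (bd n (k + 1) :: 'k ratfun mat) * (cobd n (k + 1) * cobd n k * bd n k)"
    unfolding L_ud_def L_du_def assoc_mult_mat[OF carr(1,2) mult_carrier_mat[OF carr(3,4)]]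
    by (simp only: assoc_mult_mat[OF carr(2,3,4)])
  ultimately show ?thesis using carr by simp
qed

lemma spec_L_tot:
  "spec (L_tot n k :: 'k::field ratfun mat)
    = image_mset (\<lambda>f. to_ac (cube_eig cube_wt 1 f)) (mset (col_faces n k))"
proof -
  let ?c = "col_faces n k" and ?l = "cube_eig cube_wt 1 :: face \<Rightarrow> 'k ratfun"
  let ?P = "face_prod (edge_eigvec cube_wt) 1 :: face \<Rightarrow> face \<Rightarrow> 'k ratfun"
    and ?Q = "face_prod (edge_coeigvec cube_wt) 1 :: face \<Rightarrow> face \<Rightarrow> 'k ratfun"
  let ?D = "mat (length ?c) (length ?c) (\<lambda>(i, j). if i = j then ?l (?c ! i) else 0)"
  have D: "?D = face_mat (\<lambda>f g. if f = g then ?l f else 0) ?c ?c"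
    by (auto simp: face_mat_def nth_eq_iff_index_eq)
  have PQ: "face_mat ?P ?c ?c * face_mat ?Q ?c ?c = 1\<^sub>m (length ?c)"
  proof -
    have "(\<Sum>h | length h = n \<and> fdim h = k. ?P f h * ?Q h g) = (if f = g then 1 else 0)"
      if "length f = n" "fdim f = k" "length g = n" for f g
      by (subst sum_faces_fdim)
        (use that in \<open>auto simp: eigvec_eq_0 eigvec_coeigvec cube_wt_eq_u_wt u_wt_nonzero\<close>)
    then show ?thesis by (simp add: face_mat_mult flip: face_mat_1) (auto intro!: face_mat_cong)
  qed
  have "face_mat (cube_lap cube_wt 1) ?c ?c * face_mat ?P ?c ?c = face_mat ?P ?c ?c * ?D"
  proof -
    have "(\<Sum>h | length h = n \<and> fdim h = k. cube_lap cube_wt 1 f h * ?P h g)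
      = (\<Sum>h | length h = n \<and> fdim h = k. ?P f h * (if h = g then ?l h else 0))"
      if "length f = n" "fdim f = k" "length g = n" "fdim g = k" for f g
    proof -
      have "(\<Sum>h | length h = n \<and> fdim h = k. cube_lap cube_wt 1 f h * ?P h g)
        = (\<Sum>h | length h = n. cube_lap cube_wt 1 f h * ?P h g)"
        by (rule sum_faces_fdim) (use that in \<open>auto simp: eigvec_eq_0\<close>)
      also have "\<dots> = ?l g * ?P f g" using that by (simp add: cube_lap_eigvec)
      also have "\<dots> = (\<Sum>h | length h = n. ?P f h * (if h = g then ?l h else 0))"
        using that by (simp add: if_distrib[of "\<lambda>x. _ * x"] cong: if_cong)
      also have "\<dots> = (\<Sum>h | length h = n \<and> fdim h = k. ?P f h * (if h = g then ?l h else 0))"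
        by (rule sum_faces_fdim[symmetric]) (use that in auto)
      finally show ?thesis .
    qed
    then show ?thesis unfolding D by (simp add: face_mat_mult) (auto intro!: face_mat_cong)
  qed
  then have "spec (L_tot n k) = image_mset (\<lambda>i. to_ac (?l (?c ! i))) (mset [0..<length ?c])"
    unfolding L_tot_eq_face_mat by (intro spec_diagonalisable[OF _ _ _ PQ]) auto
  also have "\<dots> = image_mset (\<lambda>f. to_ac (?l f)) (mset (map ((!) ?c) [0..<length ?c]))"
    by (simp add: image_mset.compositionality o_def)
  finally show ?thesis by (simp only: map_nth)
qed

section \<open>Generating functions of the spectra\<close>

lemma rexp_add: "rexp (a + b) = rexp a * rexp b"
  by (simp add: rexp_def mult_single)

lemma rexp_0 [simp]: "rexp 0 = 1"
  by (simp add: rexp_def)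

text \<open>A first coordinate \<open>Zero\<close> adds nothing to the eigenvalue and the dimension, \<open>One\<close> adds \<open>u\<close> to the
  eigenvalue, and \<open>Star\<close> adds \<open>u\<close> to the eigenvalue and 1 to the dimension.\<close>

lemma sum_monom_cube_eig:
  fixes w :: "nat \<Rightarrow> csym \<Rightarrow> 'k::field ratfun"
  shows "(\<Sum>f | length f = n. monom (rexp (to_ac (cube_eig w i f))) (fdim f) :: 'k genfun)
    = (\<Prod>k = i..<i + n. 1 + [:rexp (to_ac (edge_eig w k)):] + t_var * [:rexp (to_ac (edge_eig w k)):])"
proof (induction n arbitrary: i)
  case 0
  then show ?case by simp
next
  case (Suc n)
  define r where "r = [:rexp (to_ac (edge_eig w i)):]"
  define m where "m f = (monom (rexp (to_ac (cube_eig w (Suc i) f))) (fdim f) :: 'k genfun)" for f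
  have "(\<Sum>f | length f = Suc n. monom (rexp (to_ac (cube_eig w i f))) (fdim f) :: 'k genfun)
    = (\<Sum>f | length f = n. m f) + (\<Sum>f | length f = n. r * m f)
      + (\<Sum>f | length f = n. t_var * r * m f)"
    unfolding sum_faces_Suc m_def r_def t_var_def
    by (simp add: rexp_add mult_monom smult_monom monom_0[symmetric] del: monom_0)
  also have "\<dots> = (1 + r + t_var * r) * (\<Sum>f | length f = n. m f)"
    by (simp add: algebra_simps flip: sum_distrib_left)
  also have "(\<Sum>f | length f = n. m f)
    = (\<Prod>k = Suc i..<Suc i + n.
        1 + [:rexp (to_ac (edge_eig w k)):] + t_var * [:rexp (to_ac (edge_eig w k)):])"
    unfolding m_def by (rule Suc.IH)
  finally show ?case by (simp add: r_def prod.atLeast_Suc_lessThan)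
qed

lemma fdim_le_length: "fdim f \<le> length f"
  by (induction f) auto

lemma E_tot_eq_prod: "(E_tot n :: 'k::field genfun) = (\<Prod>k = 1..n. 1 + ru k + t_var * ru k)"
proof -
  let ?m = "\<lambda>f. monom (rexp (to_ac (cube_eig cube_wt 1 f))) (fdim f) :: 'k genfun"
  have "(E_tot n :: 'k genfun) = (\<Sum>k = 0..n. \<Sum>f | f \<in> {f. length f = n} \<and> fdim f = k. ?m f)"
    unfolding E_tot_def E_gen_def
    by (intro sum.cong)
      (auto simp: spec_L_tot image_mset.compositionality o_def sum_mset_sum_list
        sum.distinct_set_conv_list[symmetric] simp flip: mset_map intro!: sum.cong)
  also have "\<dots> = (\<Sum>f | length f = n. ?m f)"
    by (rule sum.group) (use fdim_le_length in auto)
  also have "\<dots> = (\<Prod>k = 1..<1 + n. 1 + ru k + t_var * ru k)"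
    by (simp only: sum_monom_cube_eig cube_wt_eq_u_wt ru_def)
  also have "{1..<1 + n} = {1..n}" by auto
  finally show ?thesis .
qed

text \<open>Each factor is \<open>1 + (1 + t) r k\<close>, so a choice of the second summand for all \<open>k\<close> in a set \<open>S\<close>
  contributes \<open>(1 + t) ^ card S\<close>.\<close>

lemma prod_eq_sum_card_subsets:
  fixes r :: "'i \<Rightarrow> 'a::comm_semiring_1"
  assumes "finite I"
  shows "(\<Prod>k\<in>I. 1 + r k + t * r k)
    = (\<Sum>j = 0..card I. (1 + t) ^ j * (\<Sum>S | S \<subseteq> I \<and> card S = j. \<Prod>k\<in>S. r k))"
proof -
  have "(\<Prod>k\<in>I. 1 + r k + t * r k) = (\<Prod>k\<in>I. (1 + t) * r k + 1)"
    by (simp add: algebra_simps)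
  also have "\<dots> = (\<Sum>S\<in>Pow I. (1 + t) ^ card S * (\<Prod>k\<in>S. r k))"
    using assms by (simp add: prod_add prod.distrib)
  also have "\<dots> = (\<Sum>j = 0..card I. \<Sum>S | S \<in> Pow I \<and> card S = j.
      (1 + t) ^ card S * (\<Prod>k\<in>S. r k))"
    by (rule sum.group[symmetric]) (use assms in \<open>auto intro: card_mono\<close>)
  also have "\<dots> = (\<Sum>j = 0..card I. (1 + t) ^ j * (\<Sum>S | S \<subseteq> I \<and> card S = j. \<Prod>k\<in>S. r k))"
    unfolding sum_distrib_left Pow_def by (intro sum.cong refl) auto
  finally show ?thesis .
qed

lemma sum_one_add_power_expand:
  fixes e :: "nat \<Rightarrow> 'a::comm_semiring_1"
  shows "(\<Sum>k = 0..n. (1 + t) ^ k * e k)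
    = (\<Sum>i = 0..n. t ^ i * (\<Sum>k = i..n. of_nat (k choose i) * e k))"
proof -
  have "(1 + t) ^ k = (\<Sum>i = 0..n. of_nat (k choose i) * t ^ i)" if "k \<le> n" for k
  proof -
    have "(1 + t) ^ k = (\<Sum>i = 0..k. of_nat (k choose i) * t ^ i)"
      using binomial_ring[of t 1 k] by (simp add: add.commute atLeast0AtMost)
    also have "\<dots> = (\<Sum>i = 0..n. of_nat (k choose i) * t ^ i)"
      by (rule sum.mono_neutral_left) (use that in \<open>auto simp: binomial_eq_0\<close>)
    finally show ?thesis .
  qed
  then have "(\<Sum>k = 0..n. (1 + t) ^ k * e k)
    = (\<Sum>k = 0..n. \<Sum>i = 0..n. t ^ i * (of_nat (k choose i) * e k))"
    by (simp add: sum_distrib_left sum_distrib_right mult_ac)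
  also have "\<dots> = (\<Sum>i = 0..n. t ^ i * (\<Sum>k = 0..n. of_nat (k choose i) * e k))"
    by (subst sum.swap) (simp add: sum_distrib_left)
  also have "\<dots> = (\<Sum>i = 0..n. t ^ i * (\<Sum>k = i..n. of_nat (k choose i) * e k))"
    by (intro sum.cong refl arg_cong2[of _ _ _ _ "(*)"] sum.mono_neutral_right)
      (auto simp: binomial_eq_0)
  finally show ?thesis .
qed

lemma lookup_coeff_E_gen:
  assumes "\<And>k. k > n \<Longrightarrow> spec (L n k) = {#}"
  shows "Poly_Mapping.lookup (coeff (E_gen n L) k) l = int (count (spec (L n k)) l)"
proof -
  have monoms: "Poly_Mapping.lookup (coeff (\<Sum>m\<in>#M. monom (rexp m) j) k) l
    = (if j = k then int (count M l) else 0)" for M :: "'a ratfun alg_closure multiset" and j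
    by (induction M) (auto simp: lookup_add rexp_def lookup_single when_def)
  have "Poly_Mapping.lookup (coeff (E_gen n L) k) l
    = (\<Sum>j = 0..n. if j = k then int (count (spec (L n j)) l) else 0)"
    by (simp add: E_gen_def coeff_sum lookup_sum monoms)
  also have "\<dots> = int (count (spec (L n k)) l)"
    using assms[of k] by (cases "k \<le> n") auto
  finally show ?thesis .
qed

lemma spec_beyond_dim:
  assumes "k > n"
  shows "spec (L_ud n k :: 'k::field ratfun mat) = {#}" "spec (L_tot n k :: 'k ratfun mat) = {#}"
proof -
  have "set (col_faces n k) = {}"
    using assms by (auto simp: not_le dest: order.strict_trans2[OF _ fdim_le_length])
  then have "col_faces n k = []" by (simp only: set_empty)
  then show "spec (L_ud n k :: 'k ratfun mat) = {#}" "spec (L_tot n k :: 'k ratfun mat) = {#}"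
    using L_carrier(1)[of n k, where 'a = 'k] by (simp_all add: spec_0_dim spec_L_tot)
qed

text \<open>The up-down and the down-up Laplacian annihilate each other, so their nonzero spectra add up. The
  down-up Laplacian is \<open>\<partial>\<^sup>T \<partial>\<close>, which shares its nonzero spectrum with \<open>\<partial> \<partial>\<^sup>T\<close>, the up-down
  Laplacian one dimension below.\<close>

lemma count_spec_L_tot:
  assumes "l \<noteq> 0"
  shows "count (spec (L_tot n k :: 'k::field ratfun mat)) l
    = count (spec (L_ud n k)) l + (if k = 0 then 0 else count (spec (L_ud n (k - 1))) l)"
proof -
  have bd: "(bd n k :: 'k ratfun mat) \<in> carrier_mat (length (row_faces n k)) (length (col_faces n k))"
    "(cobd n k :: 'k ratfun mat) \<in> carrier_mat (length (col_faces n k)) (length (row_faces n k))"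
    by (simp_all add: bd_eq_face_mat cobd_eq_face_mat)
  have "count (spec (L_du n k)) l = count (spec (bd n k * cobd n k :: 'k ratfun mat)) l"
    unfolding L_du_def by (rule count_spec_mult_commute[OF bd(2,1) assms])
  also have "\<dots> = (if k = 0 then 0 else count (spec (L_ud n (k - 1))) l)"
    using bd by (auto simp: L_ud_def row_faces_0 spec_0_dim)
  finally show ?thesis
    unfolding L_tot_def count_spec_add_if_mult_eq_0[OF L_carrier L_ud_mult_L_du assms] by simp
qed

lemma coeff_t_var_mult: "coeff (t_var * p) k = (if k = 0 then 0 else coeff p (k - 1))"
  by (cases k) (auto simp: t_var_def coeff_monom_mult)

text \<open>The constant term of \<open>1 + t\<close> is 1, so the coefficients of \<open>p\<close> are recovered recursively from
  those of \<open>(1 + t) p\<close>.\<close>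

lemma eq_upto_const_if_one_add_t_mult:
  assumes "(1 + t_var) * p \<doteq> (1 + t_var) * q"
  shows "p \<doteq> q"
  unfolding eq_upto_const_def
proof (intro allI impI)
  fix k and l :: "'a ratfun alg_closure" assume l: "l \<noteq> 0"
  show "Poly_Mapping.lookup (coeff p k) l = Poly_Mapping.lookup (coeff q k) l"
  proof (induction k)
    case 0
    have "Poly_Mapping.lookup (coeff ((1 + t_var) * p) 0) l
      = Poly_Mapping.lookup (coeff ((1 + t_var) * q) 0) l"
      using assms l unfolding eq_upto_const_def by blast
    then show ?case
      by (simp add: distrib_right coeff_t_var_mult)
  next
    case (Suc k)
    have "Poly_Mapping.lookup (coeff ((1 + t_var) * p) (Suc k)) l
      = Poly_Mapping.lookup (coeff ((1 + t_var) * q) (Suc k)) l"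
      using assms l unfolding eq_upto_const_def by blast
    with Suc show ?case
      by (simp add: distrib_right coeff_t_var_mult lookup_add)
  qed
qed

lemma E_tot_doteq_E_ud: "(1 + t_var) * E_ud n \<doteq> E_tot n"
  unfolding eq_upto_const_def
proof (intro allI impI)
  fix k and l :: "'a ratfun alg_closure" assume l: "l \<noteq> 0"
  have "Poly_Mapping.lookup (coeff (E_ud n) k) l = int (count (spec (L_ud n k)) l)" for k
    unfolding E_ud_def by (rule lookup_coeff_E_gen) (rule spec_beyond_dim)
  moreover have "Poly_Mapping.lookup (coeff (E_tot n) k) l = int (count (spec (L_tot n k)) l)"
    unfolding E_tot_def by (rule lookup_coeff_E_gen) (rule spec_beyond_dim)
  ultimately show "Poly_Mapping.lookup (coeff ((1 + t_var) * E_ud n) k) l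
      = Poly_Mapping.lookup (coeff (E_tot n) k) l"
    by (simp add: distrib_right coeff_t_var_mult lookup_add count_spec_L_tot[OF l])
qed

theorem theorem4p2:
  fixes n :: nat
  assumes "n \<ge> 1"
  shows "(E_tot n :: 'k::field genfun) = (\<Prod>k = 1..n. 1 + ru k + t_var * ru k)
    \<and> (\<Prod>k = 1..n. 1 + ru k + t_var * ru k :: 'k genfun)
        = (\<Sum>i = 0..n. t_var ^ i * (\<Sum>k = i..n. of_nat (k choose i) * esym n k))
    \<and> (E_ud n :: 'k genfun) \<doteq> (\<Sum>j = 1..n. (1 + t_var) ^ (j - 1) * esym n j)
    \<and> (\<Sum>j = 1..n. (1 + t_var) ^ (j - 1) * esym n j :: 'k genfun)
        = (\<Sum>i = 0..n - 1. t_var ^ i * (\<Sum>j = i + 1..n. of_nat ((j - 1) choose i) * esym n j))"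
proof (intro conjI)
  let ?F = "\<Sum>j = 1..n. (1 + t_var) ^ (j - 1) * esym n j :: 'k genfun"
  obtain m where n: "n = Suc m" using assms by (cases n) auto
  have F_shift: "?F = (\<Sum>k = 0..m. (1 + t_var) ^ k * esym n (k + 1))"
    using sum.shift_bounds_cl_Suc_ivl[of "\<lambda>j. (1 + t_var) ^ (j - 1) * (esym n j :: 'k genfun)" 0 m]
    by (simp add: n)
  have prod: "(\<Prod>k = 1..n. 1 + ru k + t_var * ru k :: 'k genfun)
    = (\<Sum>k = 0..n. (1 + t_var) ^ k * esym n k)"
    using prod_eq_sum_card_subsets[of "{1..n}" "ru :: nat \<Rightarrow> 'k genfun" t_var]
    by (simp add: esym_def)
  show "(E_tot n :: 'k genfun) = (\<Prod>k = 1..n. 1 + ru k + t_var * ru k)"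
    by (rule E_tot_eq_prod)
  show "(\<Prod>k = 1..n. 1 + ru k + t_var * ru k :: 'k genfun)
      = (\<Sum>i = 0..n. t_var ^ i * (\<Sum>k = i..n. of_nat (k choose i) * esym n k))"
    unfolding prod by (rule sum_one_add_power_expand)
  show "?F = (\<Sum>i = 0..n - 1. t_var ^ i * (\<Sum>j = i + 1..n. of_nat ((j - 1) choose i) * esym n j))"
    unfolding F_shift sum_one_add_power_expand
    by (simp add: n sum.shift_bounds_cl_Suc_ivl del: sum.cl_ivl_Suc)
  have "{S. S \<subseteq> {1..n} \<and> card S = 0} = {{}}"
    by (auto dest: finite_subset)
  then have "esym n 0 = (1 :: 'k genfun)" by (simp only: esym_def) simp
  moreover have "(\<Sum>k = 0..n. (1 + t_var) ^ k * esym n k) = esym n 0 + (1 + t_var) * ?F"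
    unfolding F_shift unfolding n sum.atLeast0_atMost_Suc_shift
    by (simp add: sum_distrib_left mult.assoc)
  ultimately have "E_tot n = 1 + (1 + t_var) * ?F"
    unfolding E_tot_eq_prod prod by simp
  moreover have "Poly_Mapping.lookup (coeff (1 :: 'k genfun) k) l = 0" if "l \<noteq> 0" for k l
    using that by (auto simp: lookup_one when_def)
  ultimately have "(1 + t_var) * E_ud n \<doteq> (1 + t_var) * ?F"
    using E_tot_doteq_E_ud[of n, where 'a = 'k] by (simp add: eq_upto_const_def lookup_add)
  then show "E_ud n \<doteq> ?F"
    by (rule eq_upto_const_if_one_add_t_mult)
qed

end
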